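(* Let $\mathscr{A}$ be a function clone and let $\mathscr{B}$ be the polymorphism clone of a relational structure $\mathbb{B}$. Then the following are equivalent. \begin{itemize} \item[(i)] There exists an h1 clone homomorphism from $\mathscr{A}$ into $\mathscr{B}$. \item[(ii)] $\mathscr{A}$ is $\mathbb{B}$-colorable. \end{itemize}
   Context: Domains are nonempty. A function clone on a set $A$ is a set of finitary operations (arity $\ge 1$) on $A$ containing all projections and closed under composition; $\pi^m_i$ denotes the $m$-ary projection onto the $i$-th coordinate. The polymorphism clone of $\mathbb{B}$ is the set of all finitary operations (arity $\ge1$) on its domain $B$ preserving all relations of $\mathbb{B}$. An h1 clone homomorphism is an arity-preserving map $\xi\colon\mathscr{A}\to\mathscr{B}$ with $\xi(f(\pi^m_{i_1},\dots,\pi^m_{i_n}))=\xi(f)(\pi^m_{i_1},\dots,\pi^m_{i_n})$ for all $n,m\ge1$, all $i_1,\dots,i_n\in\{1,\dots,m\}$ and all $n$-ary $f\in\mathscr{A}$. Let $\mathscr{A}$ be a function clone on $A$ and $B$ a set. For $b\in B$ let $\pi^B_b\in A^{A^B}$ be the function projecting every tuple in $A^B$ onto its $b$-th coordinate. Let $F_{\mathscr{A}}(B)\subseteq A^{A^B}$ be the closure of $\{\pi^B_b: b\in B\}$ under the componentwise action of $\mathscr{A}$. For a relation $R\subseteq B^k$ let $R^{\mathscr{A}}\subseteq F_{\mathscr{A}}(B)^k$ be the closure of $\{(\pi^B_{b_1},\dots,\pi^B_{b_k}) : (b_1,\dots,b_k)\in R\}$ under the componentwise action of $\mathscr{A}$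 (acting on $F_{\mathscr{A}}(B)$). A coloring of $\mathscr{A}$ by $\mathbb{B}$ is a map $c\colon F_{\mathscr{A}}(B)\to B$ such that for every relation $R$ of $\mathbb{B}$ and every $(f_1,\dots,f_k)\in R^{\mathscr{A}}$ we have $(c(f_1),\dots,c(f_k))\in R$. $\mathscr{A}$ is $\mathbb{B}$-colorable if such a coloring exists. *)

theory Defs
  imports "HOL-Library.FuncSet" "HOL-Library.NList"
begin

text \<open>
  The set of \<open>n\<close>-tuples over \<open>A\<close> is \<^const>\<open>nlists\<close>, i.e. lists of length \<open>n\<close> with entries in \<open>A\<close>.
  An operation carries its arity explicitly: extensional functions on \<open>n\<close>-tuples of different
  arities may coincide as HOL functions (e.g. when \<open>A = {undefined}\<close>).
  Coordinates are counted from 0.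
\<close>

type_synonym 'a operation = "nat \<times> ('a list \<Rightarrow> 'a)"

definition operations :: "'a set \<Rightarrow> 'a operation set" where
  "operations A = {(n, f). n \<ge> 1 \<and> f \<in> nlists n A \<rightarrow>\<^sub>E A}"

definition proj :: "'a set \<Rightarrow> nat \<Rightarrow> nat \<Rightarrow> 'a operation" where
  "proj A m i = (m, \<lambda>xs\<in>nlists m A. xs ! i)"

text \<open>The \<open>m\<close>-ary operation \<open>f(g\<^sub>1,\<dots>,g\<^sub>n)\<close>, for \<open>m\<close>-ary \<open>g\<^sub>1,\<dots>,g\<^sub>n\<close>.\<close>

definition compose_op :: "'a set \<Rightarrow> nat \<Rightarrow> 'a operation \<Rightarrow> 'a operation list \<Rightarrow> 'a operation" where
  "compose_op A m f gs = (m, \<lambda>xs\<in>nlists m A. snd f (map (\<lambda>g. snd g xs) gs))"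

definition function_clone :: "'a set \<Rightarrow> 'a operation set \<Rightarrow> bool" where
  "function_clone A C \<longleftrightarrow>
     A \<noteq> {} \<and> C \<subseteq> operations A \<and>
     (\<forall>m i. i < m \<longrightarrow> proj A m i \<in> C) \<and>
     (\<forall>f\<in>C. \<forall>m\<ge>1. \<forall>gs\<in>nlists (fst f) {g \<in> C. fst g = m}. compose_op A m f gs \<in> C)"

text \<open>A relation is paired with its arity; there may be arbitrarily many relations.\<close>

type_synonym 'b relation = "nat \<times> 'b list set"

definition relational_structure :: "'b set \<Rightarrow> 'b relation set \<Rightarrow> bool" where
  "relational_structure B Rs \<longleftrightarrow> B \<noteq> {} \<and> (\<forall>(k, R)\<in>Rs. R \<subseteq> nlists k B)"

text \<open>
  The componentwise action on \<open>k\<close>-tuples: \<open>rs\<close> is the list of the \<open>n\<close> argument tuples, and the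
  \<open>j\<close>-th entry of the result is \<open>f\<close> applied to the \<open>j\<close>-th entries of the arguments.
\<close>

definition componentwise :: "nat \<Rightarrow> ('x list \<Rightarrow> 'x) \<Rightarrow> 'x list list \<Rightarrow> 'x list" where
  "componentwise k f rs = map (\<lambda>j. f (map (\<lambda>r. r ! j) rs)) [0..<k]"

definition preserves :: "'b operation \<Rightarrow> 'b relation \<Rightarrow> bool" where
  "preserves f R \<longleftrightarrow>
     (\<forall>rs\<in>nlists (fst f) (snd R). componentwise (fst R) (snd f) rs \<in> snd R)"

definition polymorphism_clone :: "'b set \<Rightarrow> 'b relation set \<Rightarrow> 'b operation set" where
  "polymorphism_clone B Rs = {f \<in> operations B. \<forall>R\<in>Rs. preserves f R}"

definition h1_clone_homomorphism ::
  "'a set \<Rightarrow> 'a operation set \<Rightarrow> 'b set \<Rightarrow> 'b operation set \<Rightarrow> ('a operation \<Rightarrow> 'b operation) \<Rightarrow> bool"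
where
  "h1_clone_homomorphism A C B D \<xi> \<longleftrightarrow>
     \<xi> \<in> C \<rightarrow> D \<and>
     (\<forall>f\<in>C. fst (\<xi> f) = fst f) \<and>
     (\<forall>f\<in>C. \<forall>m\<ge>1. \<forall>is\<in>nlists (fst f) {..<m}.
        \<xi> (compose_op A m f (map (proj A m) is)) = compose_op B m (\<xi> f) (map (proj B m) is))"

text \<open>
  The closure of \<open>X\<close> under the operations of \<open>C\<close>, where \<open>act f\<close> says how a member \<open>f\<close> of \<open>C\<close>
  acts on lists of elements of type \<open>'x\<close>.
\<close>

inductive_set action_closure ::
  "'a operation set \<Rightarrow> (('a list \<Rightarrow> 'a) \<Rightarrow> 'x list \<Rightarrow> 'x) \<Rightarrow> 'x set \<Rightarrow> 'x set"
  for C act X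
where
  base: "x \<in> X \<Longrightarrow> x \<in> action_closure C act X"
| step: "(n, f) \<in> C \<Longrightarrow> length xs = n \<Longrightarrow> \<forall>x\<in>set xs. x \<in> action_closure C act X \<Longrightarrow>
         act f xs \<in> action_closure C act X"

text \<open>
  \<open>A\<^bsup>B\<^esup>\<close> is \<open>B \<rightarrow>\<^sub>E A\<close>, and elements of the power of \<open>A\<close> with exponent \<open>A\<^bsup>B\<^esup>\<close> are represented as
  extensional functions on \<open>B \<rightarrow>\<^sub>E A\<close>.
\<close>

definition coord_proj :: "'a set \<Rightarrow> 'b set \<Rightarrow> 'b \<Rightarrow> ('b \<Rightarrow> 'a) \<Rightarrow> 'a" where
  "coord_proj A B b = (\<lambda>t\<in>B \<rightarrow>\<^sub>E A. t b)"

definition power_action ::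
  "'a set \<Rightarrow> 'b set \<Rightarrow> ('a list \<Rightarrow> 'a) \<Rightarrow> (('b \<Rightarrow> 'a) \<Rightarrow> 'a) list \<Rightarrow> ('b \<Rightarrow> 'a) \<Rightarrow> 'a" where
  "power_action A B f gs = (\<lambda>t\<in>B \<rightarrow>\<^sub>E A. f (map (\<lambda>g. g t) gs))"

definition free_algebra :: "'a set \<Rightarrow> 'a operation set \<Rightarrow> 'b set \<Rightarrow> (('b \<Rightarrow> 'a) \<Rightarrow> 'a) set" where
  "free_algebra A C B = action_closure C (power_action A B) (coord_proj A B ` B)"

text \<open>The relation \<open>R\<^sup>\<A>\<close> on the free algebra, as a set of tuples.\<close>

definition free_relation ::
  "'a set \<Rightarrow> 'a operation set \<Rightarrow> 'b set \<Rightarrow> 'b relation \<Rightarrow> (('b \<Rightarrow> 'a) \<Rightarrow> 'a) list set" where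
  "free_relation A C B R =
     action_closure C (\<lambda>f. componentwise (fst R) (power_action A B f))
       (map (coord_proj A B) ` snd R)"

definition coloring ::
  "'a set \<Rightarrow> 'a operation set \<Rightarrow> 'b set \<Rightarrow> 'b relation set \<Rightarrow> ((('b \<Rightarrow> 'a) \<Rightarrow> 'a) \<Rightarrow> 'b) \<Rightarrow> bool"
where
  "coloring A C B Rs c \<longleftrightarrow>
     c \<in> free_algebra A C B \<rightarrow> B \<and>
     (\<forall>R\<in>Rs. \<forall>fs\<in>free_relation A C B R. map c fs \<in> snd R)"

definition colorable :: "'a set \<Rightarrow> 'a operation set \<Rightarrow> 'b set \<Rightarrow> 'b relation set \<Rightarrow> bool" where
  "colorable A C B Rs \<longleftrightarrow> (\<exists>c. coloring A C B Rs c)"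

end

theory Submission
  imports Defs
begin

text \<open>
  An element of the free algebra is a term operation \<open>f(\<pi>\<^sub>b\<^sub>1,\<dots>,\<pi>\<^sub>b\<^sub>n)\<close> with \<open>f\<close> in the clone, because
  iterated applications of the clone collapse to a single one: the inner operations can be given a
  common list of variables by taking minors, and then composed (\<open>action_closure_normal_form\<close>).
  The same holds for the tuples in a relation \<open>R\<^sup>\<A>\<close>, which are \<open>f\<close> applied to tuples of generators
  from \<open>R\<close>. The equivalence is then the dictionary
  \<open>c(f(\<pi>\<^sub>b\<^sub>1,\<dots>,\<pi>\<^sub>b\<^sub>n)) = \<xi>(f)(b\<^sub>1,\<dots>,b\<^sub>n)\<close>.

  Read from right to left, it defines a coloring \<open>c\<close> from a homomorphism \<open>\<xi>\<close>. The point is that \<open>c\<close> is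
  well defined: if two terms agree in the free algebra, then after listing the finitely many
  elements of \<open>B\<close> involved without repetition, the two operations have a common minor, and \<open>\<xi>\<close>
  respects minors (\<open>h1_homomorphism_respects_terms\<close>). Read from left to right, it defines \<open>\<xi>\<close> from
  \<open>c\<close>, and \<open>\<xi>\<close> respects minors because a minor of \<open>f\<close> and \<open>f\<close> itself yield the same element of the
  free algebra when the variables are identified accordingly. On both sides, that \<open>c\<close> respects the
  relation \<open>R\<close> says exactly that every \<open>\<xi>(f)\<close> preserves \<open>R\<close>.
\<close>

section \<open>Minors of operations in a clone\<close>

(* The premise of each rule has a variable that is absent from the conclusion; once nlists_def is
   unfolded, that premise contains an instance of the conclusion and the simplifier loops. *)
declare nlistsE_length [simp del] nlistsE_set [simp del]

lemma proj_in_clone: "function_clone A C \<Longrightarrow> i < m \<Longrightarrow> proj A m i \<in> C"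
  by (simp add: function_clone_def)

lemma compose_op_in_clone:
  "\<lbrakk>function_clone A C; f \<in> C; m \<ge> 1; gs \<in> nlists (fst f) {g \<in> C. fst g = m}\<rbrakk>
    \<Longrightarrow> compose_op A m f gs \<in> C"
  by (simp add: function_clone_def)

lemma clone_arity_pos: "function_clone A C \<Longrightarrow> f \<in> C \<Longrightarrow> fst f \<ge> 1"
  by (auto simp: function_clone_def operations_def)

lemma operation_value: "g \<in> operations B \<Longrightarrow> xs \<in> nlists (fst g) B \<Longrightarrow> snd g xs \<in> B"
  by (auto simp: operations_def)

lemma fst_proj [simp]: "fst (proj A m i) = m"
  by (simp add: proj_def)

definition minor :: "'a set \<Rightarrow> nat \<Rightarrow> 'a operation \<Rightarrow> nat list \<Rightarrow> 'a operation" where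
  "minor A m f is = compose_op A m f (map (proj A m) is)"

lemma fst_minor [simp]: "fst (minor A m f is) = m"
  by (simp add: minor_def compose_op_def)

lemma projs_in_nlists:
  assumes "function_clone A C" "is \<in> nlists n {..<m}"
  shows "map (proj A m) is \<in> nlists n {g \<in> C. fst g = m}"
  using assms by (auto simp: nlists_def proj_in_clone)

lemma minor_in_clone:
  assumes "function_clone A C" "f \<in> C" "m \<ge> 1" "is \<in> nlists (fst f) {..<m}"
  shows "minor A m f is \<in> C"
  unfolding minor_def using assms by (intro compose_op_in_clone projs_in_nlists)

lemma snd_minor:
  assumes "xs \<in> nlists m A" "set is \<subseteq> {..<m}"
  shows "snd (minor A m f is) xs = snd f (map ((!) xs) is)"
  using assms by (simp add: minor_def compose_op_def proj_def comp_def)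

lemma list_as_reindexing:
  assumes "set xs \<subseteq> set ys"
  obtains "is" where "is \<in> nlists (length xs) {..<length ys}" "xs = map ((!) ys) is"
proof -
  have "\<forall>x\<in>set xs. \<exists>i<length ys. ys ! i = x"
    using assms by (auto simp: in_set_conv_nth subset_iff)
  then obtain idx where idx: "\<forall>x\<in>set xs. idx x < length ys \<and> ys ! idx x = x"
    by metis
  show thesis
    by (rule that[of "map idx xs"]) (use idx in \<open>auto simp: nlists_def map_idI\<close>)
qed

section \<open>Normal forms for closures under a clone action\<close>

text \<open>
  In \<open>f(g\<^sub>1(ys\<^sub>1),\<dots>,g\<^sub>n(ys\<^sub>n))\<close> the inner operations act on different lists of generators. Replacing
  every \<open>g\<^sub>i\<close> by a minor, all of them act on the concatenation of the \<open>ys\<^sub>i\<close>, and the outer \<open>f\<close> can be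
  composed with them inside the clone. Compatibility of \<open>act\<close> with projections and composition is
  required on lists of generators only, because no other arguments occur in this computation; the
  actions considered below satisfy it there, but not for arbitrary elements of their type.
\<close>

lemma action_closure_normal_form:
  assumes clone: "function_clone A C"
    and act_proj: "\<And>m i xs. \<lbrakk>i < m; xs \<in> nlists m X\<rbrakk> \<Longrightarrow> act (snd (proj A m i)) xs = xs ! i"
    and act_compose: "\<And>m f gs xs. \<lbrakk>f \<in> C; gs \<in> nlists (fst f) {g \<in> C. fst g = m}; xs \<in> nlists m X\<rbrakk>
      \<Longrightarrow> act (snd (compose_op A m f gs)) xs = act (snd f) (map (\<lambda>g. act (snd g) xs) gs)"
    and "x \<in> action_closure C act X"
  obtains f xs where "f \<in> C" "xs \<in> nlists (fst f) X" "x = act (snd f) xs"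
proof -
  have "\<exists>f\<in>C. \<exists>xs\<in>nlists (fst f) X. x = act (snd f) xs"
    using assms(4)
  proof induction
    case (base x)
    have "proj A 1 0 \<in> C" using clone by (simp add: proj_in_clone)
    moreover have "[x] \<in> nlists (fst (proj A 1 0)) X" using base by (simp add: nlists_def)
    moreover have "x = act (snd (proj A 1 0)) [x]"
      using act_proj[of 0 1 "[x]"] base by (simp add: nlists_def)
    ultimately show ?case by (intro bexI)
  next
    case (step n f zs)
    then have "\<forall>z\<in>set zs. \<exists>g ys. g \<in> C \<and> ys \<in> nlists (fst g) X \<and> z = act (snd g) ys"
      by blast
    then obtain op args where normal:
      "\<forall>z\<in>set zs. op z \<in> C \<and> args z \<in> nlists (fst (op z)) X \<and> z = act (snd (op z)) (args z)"
      by metis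
    define ys where "ys = concat (map args zs)"
    let ?m = "length ys"
    have ys: "ys \<in> nlists ?m X"
      using normal by (auto simp: ys_def nlists_def)
    have "\<exists>is. is \<in> nlists (length (args z)) {..<?m} \<and> args z = map ((!) ys) is" if "z \<in> set zs" for z
      by (rule list_as_reindexing[of "args z" ys]) (use that in \<open>auto simp: ys_def\<close>)
    then obtain idx where idx:
      "\<And>z. z \<in> set zs \<Longrightarrow> idx z \<in> nlists (length (args z)) {..<?m} \<and> args z = map ((!) ys) (idx z)"
      by metis
    have len_args: "length (args z) = fst (op z)" if "z \<in> set zs" for z
      using normal that by (auto simp: nlists_def)
    \<comment> \<open>The common variable list is nonempty since operations of a clone have arity at least 1.\<close>
    have "n \<ge> 1" using clone_arity_pos[OF clone step(1)] by simp
    then obtain z where "z \<in> set zs" using step(2) by (cases zs) auto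
    then have "args z \<noteq> []"
      using normal clone_arity_pos[OF clone] len_args by fastforce
    then have m: "?m \<ge> 1"
      using \<open>z \<in> set zs\<close> by (cases ys) (auto simp: ys_def)
    define gs where "gs = map (\<lambda>z. minor A ?m (op z) (idx z)) zs"
    have gs: "gs \<in> nlists (fst (n, f)) {g \<in> C. fst g = ?m}"
      using normal idx len_args step(2) m
      by (auto simp: gs_def nlists_def[of n] intro!: minor_in_clone[OF clone])
    have "act (snd (minor A ?m (op z) (idx z))) ys = z" if z: "z \<in> set zs" for z
    proof -
      have "is": "idx z \<in> nlists (fst (op z)) {..<?m}" using idx len_args z by metis
      then have "act (snd (minor A ?m (op z) (idx z))) ys
          = act (snd (op z)) (map (\<lambda>g. act (snd g) ys) (map (proj A ?m) (idx z)))"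
        unfolding minor_def using normal z ys
        by (intro act_compose projs_in_nlists[OF clone]) auto
      also have "map (\<lambda>g. act (snd g) ys) (map (proj A ?m) (idx z)) = map ((!) ys) (idx z)"
        using "is" act_proj ys by (auto simp: nlists_def)
      finally show ?thesis using idx normal z by metis
    qed
    then have "map (\<lambda>g. act (snd g) ys) gs = zs"
      by (simp add: gs_def map_idI)
    then have "act f zs = act (snd (compose_op A ?m (n, f) gs)) ys"
      using act_compose[OF step(1) gs ys] by simp
    moreover have "compose_op A ?m (n, f) gs \<in> C"
      using compose_op_in_clone[OF clone step(1) m gs] .
    moreover have "ys \<in> nlists (fst (compose_op A ?m (n, f) gs)) X"
      using ys by (simp add: compose_op_def)
    ultimately show ?case by blast
  qed
  then show thesis using that by blast
qed

section \<open>Terms in the free algebra and in its relations\<close>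

definition free_term :: "'a set \<Rightarrow> 'b set \<Rightarrow> 'a operation \<Rightarrow> 'b list \<Rightarrow> ('b \<Rightarrow> 'a) \<Rightarrow> 'a" where
  "free_term A B f bs = power_action A B (snd f) (map (coord_proj A B) bs)"

lemma free_term_apply: "t \<in> B \<rightarrow>\<^sub>E A \<Longrightarrow> free_term A B f bs t = snd f (map t bs)"
  by (simp add: free_term_def power_action_def coord_proj_def comp_def)

text \<open>
  Passing to a minor of \<open>f\<close> and identifying the generators accordingly have the same effect on the
  free algebra; this alone makes the map read off from a coloring respect minors.
\<close>

lemma free_term_minor:
  assumes "bs \<in> nlists m B" "set is \<subseteq> {..<m}"
  shows "free_term A B (minor A m f is) bs = free_term A B f (map ((!) bs) is)"
proof
  fix t
  show "free_term A B (minor A m f is) bs t = free_term A B f (map ((!) bs) is) t"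
  proof (cases "t \<in> B \<rightarrow>\<^sub>E A")
    case True
    have "map t bs \<in> nlists m A"
      using True assms(1) by (auto simp: nlists_def PiE_iff)
    moreover have "map ((!) (map t bs)) is = map t (map ((!) bs) is)"
      using assms by (auto simp: nlists_def)
    ultimately show ?thesis
      using assms(2) True by (simp only: free_term_apply snd_minor)
  next
    case False
    then show ?thesis by (simp add: free_term_def power_action_def)
  qed
qed

lemma evaluated_generators:
  assumes "gs \<in> nlists m (coord_proj A B ` B)" "t \<in> B \<rightarrow>\<^sub>E A"
  shows "map (\<lambda>g. g t) gs \<in> nlists m A"
proof -
  have "g t \<in> A" if "g \<in> coord_proj A B ` B" for g
    using that assms(2) by (auto simp: coord_proj_def)
  then show ?thesis using assms(1) by (auto simp: nlists_def)
qed

lemma power_action_proj: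
  assumes "i < m" "gs \<in> nlists m (coord_proj A B ` B)"
  shows "power_action A B (snd (proj A m i)) gs = gs ! i"
proof
  have "gs ! i \<in> coord_proj A B ` B" using assms by (auto simp: nlists_def)
  then obtain b where b: "gs ! i = coord_proj A B b" by auto
  fix t
  show "power_action A B (snd (proj A m i)) gs t = (gs ! i) t"
    using evaluated_generators[OF assms(2)] assms b
    by (cases "t \<in> B \<rightarrow>\<^sub>E A") (auto simp: power_action_def proj_def coord_proj_def nlists_def)
qed

lemma power_action_compose:
  assumes "xs \<in> nlists m (coord_proj A B ` B)"
  shows "power_action A B (snd (compose_op A m f gs)) xs
    = power_action A B (snd f) (map (\<lambda>g. power_action A B (snd g) xs) gs)"
  using evaluated_generators[OF assms]
  by (auto simp: power_action_def compose_op_def comp_def)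

lemma nlists_image:
  assumes "xs \<in> nlists n (h ` S)"
  obtains ys where "ys \<in> nlists n S" "xs = map h ys"
proof -
  have "xs \<in> map h ` lists S" using assms by (auto simp: nlists_def simp flip: lists_image)
  then obtain ys where "ys \<in> lists S" "xs = map h ys" by blast
  then show thesis using that[of ys] assms by (auto simp: nlists_def)
qed

lemma free_algebra_cases:
  assumes "function_clone A C" "h \<in> free_algebra A C B"
  obtains f bs where "f \<in> C" "bs \<in> nlists (fst f) B" "h = free_term A B f bs"
proof -
  obtain f xs where "f \<in> C" "xs \<in> nlists (fst f) (coord_proj A B ` B)"
      "h = power_action A B (snd f) xs"
    using action_closure_normal_form[OF assms(1) power_action_proj power_action_compose
        assms(2)[unfolded free_algebra_def]] by metis
  then show thesis by (metis that nlists_image free_term_def)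
qed

lemma free_term_in_free_algebra:
  assumes "f \<in> C" "bs \<in> nlists (fst f) B"
  shows "free_term A B f bs \<in> free_algebra A C B"
  unfolding free_term_def free_algebra_def
  by (rule action_closure.step[where n = "fst f"])
    (use assms in \<open>auto simp: nlists_def intro: action_closure.base\<close>)

lemma componentwise_generators:
  assumes "\<forall>r\<in>set rs. length r = k"
  shows "componentwise k (power_action A B (snd f)) (map (map (coord_proj A B)) rs)
    = map (\<lambda>j. free_term A B f (map (\<lambda>r. r ! j) rs)) [0..<k]"
  using assms by (auto simp: componentwise_def free_term_def comp_def
      intro!: arg_cong[where f = "power_action _ _ _"])

lemma column_of_generators:
  assumes "R \<subseteq> nlists k B" "rs \<in> nlists m (map (coord_proj A B) ` R)" "j < k"
  shows "map (\<lambda>r. r ! j) rs \<in> nlists m (coord_proj A B ` B)"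
  using assms by (fastforce simp: nlists_def subset_iff)

lemma free_relation_cases:
  assumes clone: "function_clone A C" and R: "R \<subseteq> nlists k B"
    and "fs \<in> free_relation A C B (k, R)"
  obtains f rs where "f \<in> C" "rs \<in> nlists (fst f) R"
    "fs = map (\<lambda>j. free_term A B f (map (\<lambda>r. r ! j) rs)) [0..<k]"
proof -
  let ?X = "map (coord_proj A B) ` R"
  have act_proj: "componentwise k (power_action A B (snd (proj A m i))) xs = xs ! i"
    if "i < m" "xs \<in> nlists m ?X" for m i xs
  proof (rule nth_equalityI)
    have "xs ! i \<in> ?X" using that by (auto simp: nlists_def)
    then have "length (xs ! i) = k" using R by (auto simp: nlists_def)
    then show "length (componentwise k (power_action A B (snd (proj A m i))) xs) = length (xs ! i)"
      by (simp add: componentwise_def)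
    fix j assume "j < length (componentwise k (power_action A B (snd (proj A m i))) xs)"
    then have "j < k" by (simp add: componentwise_def)
    moreover have "i < length xs" using that by (auto simp: nlists_def)
    ultimately show "componentwise k (power_action A B (snd (proj A m i))) xs ! j = xs ! i ! j"
      using power_action_proj[OF that(1) column_of_generators[OF R that(2)]]
      by (simp add: componentwise_def)
  qed
  have act_compose: "componentwise k (power_action A B (snd (compose_op A m f gs))) xs
      = componentwise k (power_action A B (snd f))
          (map (\<lambda>g. componentwise k (power_action A B (snd g)) xs) gs)"
    if "xs \<in> nlists m ?X" for m f gs xs
    using power_action_compose[OF column_of_generators[OF R that]]
    by (simp add: componentwise_def comp_def)
  obtain f xs where f: "f \<in> C" "xs \<in> nlists (fst f) ?X"
      "fs = componentwise k (power_action A B (snd f)) xs"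
    using action_closure_normal_form[where act = "\<lambda>f. componentwise k (power_action A B f)",
        OF clone act_proj act_compose assms(3)[unfolded free_relation_def, simplified]]
    by metis
  obtain rs where rs: "rs \<in> nlists (fst f) R" "xs = map (map (coord_proj A B)) rs"
    using nlists_image[OF f(2)] .
  have "\<forall>r\<in>set rs. length r = k" using rs(1) R by (auto simp: nlists_def)
  then show thesis
    using that[OF f(1) rs(1)] f(3) rs(2) by (simp add: componentwise_generators)
qed

lemma term_tuple_in_free_relation:
  assumes R: "R \<subseteq> nlists k B" and f: "f \<in> C" and rs: "rs \<in> nlists (fst f) R"
  shows "map (\<lambda>j. free_term A B f (map (\<lambda>r. r ! j) rs)) [0..<k] \<in> free_relation A C B (k, R)"
proof -
  have "\<forall>r\<in>set rs. length r = k" using rs R by (auto simp: nlists_def)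
  then have "map (\<lambda>j. free_term A B f (map (\<lambda>r. r ! j) rs)) [0..<k]
      = componentwise k (power_action A B (snd f)) (map (map (coord_proj A B)) rs)"
    by (simp add: componentwise_generators)
  also have "\<dots> \<in> free_relation A C B (k, R)"
    unfolding free_relation_def fst_conv snd_conv
    by (rule action_closure.step[where n = "fst f"])
      (use f rs in \<open>auto simp: nlists_def intro!: action_closure.base\<close>)
  finally show ?thesis .
qed

lemma column_in_nlists:
  assumes "R \<subseteq> nlists k B" "rs \<in> nlists n R" "j < k"
  shows "map (\<lambda>r. r ! j) rs \<in> nlists n B"
  using assms by (fastforce simp: nlists_def subset_iff)

section \<open>From homomorphisms to colorings\<close>

text \<open>
  Since the elements of \<open>ds\<close> are distinct, every tuple \<open>xs\<close> over \<open>A\<close> is the restriction to \<open>ds\<close> of a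
  point of \<open>A\<^sup>B\<close>. Hence equality of two terms in the free algebra is equality of the corresponding
  operations on \<open>A\<close> in the variables \<open>ds\<close>.
\<close>

lemma tuple_extends_to_point:
  assumes "distinct ds" "set ds \<subseteq> B" "ds \<noteq> []" "xs \<in> nlists (length ds) A"
  obtains t where "t \<in> B \<rightarrow>\<^sub>E A" "map t ds = xs"
proof
  \<comment> \<open>Off \<open>ds\<close> any element of \<open>A\<close> will do; \<open>hd xs\<close> is one since \<open>xs\<close> is nonempty.\<close>
  let ?t = "\<lambda>b\<in>B. case map_of (zip ds xs) b of Some x \<Rightarrow> x | None \<Rightarrow> hd xs"
  have len: "length xs = length ds" and sub: "set xs \<subseteq> A" using assms(4) by (auto simp: nlists_def)
  then have "hd xs \<in> A" using assms(3) by (cases xs) auto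
  moreover have "x \<in> A" if "map_of (zip ds xs) b = Some x" for b x
    using sub set_zip_rightD[OF map_of_SomeD[OF that]] by blast
  ultimately show "?t \<in> B \<rightarrow>\<^sub>E A" by (auto split: option.split)
  show "map ?t ds = xs"
  proof (rule nth_equalityI)
    fix i assume "i < length (map ?t ds)"
    then have i: "i < length ds" by simp
    then have "map_of (zip ds xs) (ds ! i) = Some (xs ! i)"
      using len assms(1) by (simp add: map_of_zip_nth)
    moreover have "ds ! i \<in> B" using i assms(2) nth_mem by blast
    ultimately show "map ?t ds ! i = xs ! i"
      using i by simp
  qed (simp add: len)
qed

lemma minors_eq_of_free_terms_eq:
  assumes ds: "distinct ds" "set ds \<subseteq> B" "ds \<noteq> []"
    and "is": "set is \<subseteq> {..<length ds}" and js: "set js \<subseteq> {..<length ds}"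
    and eq: "free_term A B f (map ((!) ds) is) = free_term A B g (map ((!) ds) js)"
  shows "minor A (length ds) f is = minor A (length ds) g js"
proof -
  have eval: "snd (minor A (length ds) f is) xs = snd (minor A (length ds) g js) xs"
    if xs: "xs \<in> nlists (length ds) A" for xs
  proof -
    obtain t where t: "t \<in> B \<rightarrow>\<^sub>E A" "map t ds = xs"
      using tuple_extends_to_point[OF ds xs] .
    have tuple: "map ((!) xs) ks = map t (map ((!) ds) ks)" if "set ks \<subseteq> {..<length ds}" for ks
      using that t(2) by auto
    show ?thesis
      using fun_cong[OF eq, of t] tuple[OF "is"] tuple[OF js]
      by (simp only: snd_minor[OF xs "is"] snd_minor[OF xs js] free_term_apply[OF t(1)])
  qed
  show ?thesis
  proof (rule prod_eqI)
    show "snd (minor A (length ds) f is) = snd (minor A (length ds) g js)"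
    proof
      fix xs
      show "snd (minor A (length ds) f is) xs = snd (minor A (length ds) g js) xs"
        using eval[of xs]
        by (cases "xs \<in> nlists (length ds) A") (simp_all add: minor_def compose_op_def)
    qed
  qed simp
qed

lemma h1_homomorphism_minor:
  assumes "h1_clone_homomorphism A C B D \<xi>" "f \<in> C" "m \<ge> 1" "is \<in> nlists (fst f) {..<m}"
  shows "\<xi> (minor A m f is) = minor B m (\<xi> f) is"
  using assms by (simp add: h1_clone_homomorphism_def minor_def)

text \<open>
  A homomorphism compares operations through their minors, so the variables are first made common
  and distinct. The values of \<open>\<xi> f\<close> at \<open>bs\<close> and of \<open>\<xi> g\<close> at \<open>cs\<close> are then values of the images of one
  and the same minor at the list \<open>ds\<close> of these variables.
\<close>

lemma h1_homomorphism_respects_terms: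
  assumes clone: "function_clone A C" and hom: "h1_clone_homomorphism A C B D \<xi>"
    and f: "f \<in> C" "bs \<in> nlists (fst f) B" and g: "g \<in> C" "cs \<in> nlists (fst g) B"
    and eq: "free_term A B f bs = free_term A B g cs"
  shows "snd (\<xi> f) bs = snd (\<xi> g) cs"
proof -
  define ds where "ds = remdups (bs @ cs)"
  let ?m = "length ds"
  have "distinct ds" "set ds \<subseteq> B"
    using f g by (auto simp: ds_def nlists_def)
  have "bs \<noteq> []" using clone_arity_pos[OF clone f(1)] f(2) by (auto simp: nlists_def)
  then have "ds \<noteq> []" by (auto simp: ds_def)
  then have m: "?m \<ge> 1" by (cases ds) auto
  have sub_ds: "set bs \<subseteq> set ds" "set cs \<subseteq> set ds" by (auto simp: ds_def)
  have len: "length bs = fst f" "length cs = fst g" using f(2) g(2) by (auto simp: nlists_def)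
  obtain "is" where "is": "is \<in> nlists (fst f) {..<?m}" "bs = map ((!) ds) is"
    using list_as_reindexing[OF sub_ds(1)] len(1) by metis
  obtain js where js: "js \<in> nlists (fst g) {..<?m}" "cs = map ((!) ds) js"
    using list_as_reindexing[OF sub_ds(2)] len(2) by metis
  have sub: "set is \<subseteq> {..<?m}" "set js \<subseteq> {..<?m}" using "is" js by (auto simp: nlists_def)
  have "minor A ?m f is = minor A ?m g js"
    using \<open>distinct ds\<close> \<open>set ds \<subseteq> B\<close> \<open>ds \<noteq> []\<close> sub eq[unfolded "is"(2) js(2)]
    by (rule minors_eq_of_free_terms_eq)
  then have "minor B ?m (\<xi> f) is = minor B ?m (\<xi> g) js"
    using h1_homomorphism_minor[OF hom f(1) m "is"(1)] h1_homomorphism_minor[OF hom g(1) m js(1)]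
    by simp
  moreover have "ds \<in> nlists ?m B" using \<open>set ds \<subseteq> B\<close> by (simp add: nlists_def)
  ultimately show ?thesis
    using snd_minor[of ds ?m B] sub "is"(2) js(2) by metis
qed

lemma coloring_of_h1_homomorphism:
  assumes clone: "function_clone A C" and struct: "relational_structure B Rs"
    and hom: "h1_clone_homomorphism A C B (polymorphism_clone B Rs) \<xi>"
  shows "colorable A C B Rs"
proof -
  define c where "c h =
    (SOME b. \<exists>f\<in>C. \<exists>bs\<in>nlists (fst f) B. h = free_term A B f bs \<and> b = snd (\<xi> f) bs)" for h
  have c_term: "c (free_term A B f bs) = snd (\<xi> f) bs"
    if f: "f \<in> C" "bs \<in> nlists (fst f) B" for f bs
    unfolding c_def
  proof (rule some_equality)
    show "\<exists>g\<in>C. \<exists>cs\<in>nlists (fst g) B.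
        free_term A B f bs = free_term A B g cs \<and> snd (\<xi> f) bs = snd (\<xi> g) cs"
      using f by blast
  next
    fix b
    assume "\<exists>g\<in>C. \<exists>cs\<in>nlists (fst g) B. free_term A B f bs = free_term A B g cs \<and> b = snd (\<xi> g) cs"
    then show "b = snd (\<xi> f) bs"
      using h1_homomorphism_respects_terms[OF clone hom f] by metis
  qed
  have poly: "\<xi> f \<in> polymorphism_clone B Rs" "fst (\<xi> f) = fst f" if "f \<in> C" for f
    using hom that by (auto simp: h1_clone_homomorphism_def)
  have "c h \<in> B" if "h \<in> free_algebra A C B" for h
    using clone that
  proof (rule free_algebra_cases)
    fix f bs assume f: "f \<in> C" "bs \<in> nlists (fst f) B" "h = free_term A B f bs"
    have "\<xi> f \<in> operations B" using poly(1)[OF f(1)] by (simp add: polymorphism_clone_def)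
    then have "snd (\<xi> f) bs \<in> B"
      using f(2) poly(2)[OF f(1)] operation_value by metis
    then show "c h \<in> B" using c_term f by simp
  qed
  moreover have "map c fs \<in> R" if R: "(k, R) \<in> Rs" and fs: "fs \<in> free_relation A C B (k, R)" for k R fs
  proof -
    have sub: "R \<subseteq> nlists k B" using struct R by (auto simp: relational_structure_def)
    obtain f rs where f: "f \<in> C" "rs \<in> nlists (fst f) R"
        "fs = map (\<lambda>j. free_term A B f (map (\<lambda>r. r ! j) rs)) [0..<k]"
      using free_relation_cases[OF clone sub fs] .
    have "map c fs = componentwise k (snd (\<xi> f)) rs"
      using c_term[OF f(1) column_in_nlists[OF sub f(2)]]
      by (simp add: f(3) componentwise_def)
    moreover have "preserves (\<xi> f) (k, R)"
      using poly(1)[OF f(1)] R by (auto simp: polymorphism_clone_def)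
    ultimately show ?thesis
      using f(2) poly(2)[OF f(1)] by (simp add: preserves_def)
  qed
  ultimately have "coloring A C B Rs c" by (auto simp: coloring_def)
  then show ?thesis by (auto simp: colorable_def)
qed

section \<open>From colorings to homomorphisms\<close>

lemma h1_homomorphism_of_coloring:
  assumes clone: "function_clone A C" and struct: "relational_structure B Rs"
    and col: "coloring A C B Rs c"
  shows "\<exists>\<xi>. h1_clone_homomorphism A C B (polymorphism_clone B Rs) \<xi>"
proof
  define \<xi> where "\<xi> f = (fst f, \<lambda>bs\<in>nlists (fst f) B. c (free_term A B f bs))" for f
  have "\<xi> f \<in> polymorphism_clone B Rs" if f: "f \<in> C" for f
  proof -
    have "c (free_term A B f bs) \<in> B" if "bs \<in> nlists (fst f) B" for bs
      using col free_term_in_free_algebra[OF f that] by (auto simp: coloring_def)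
    then have "\<xi> f \<in> operations B"
      using clone_arity_pos[OF clone f] by (auto simp: \<xi>_def operations_def)
    moreover have "preserves (\<xi> f) (k, R)" if R: "(k, R) \<in> Rs" for k R
    proof -
      have sub: "R \<subseteq> nlists k B" using struct R by (auto simp: relational_structure_def)
      have "componentwise k (snd (\<xi> f)) rs \<in> R" if rs: "rs \<in> nlists (fst f) R" for rs
      proof -
        let ?fs = "map (\<lambda>j. free_term A B f (map (\<lambda>r. r ! j) rs)) [0..<k]"
        have "map c ?fs \<in> R"
          using col R term_tuple_in_free_relation[OF sub f rs] by (fastforce simp: coloring_def)
        moreover have "componentwise k (snd (\<xi> f)) rs = map c ?fs"
          using column_in_nlists[OF sub rs] by (simp add: componentwise_def \<xi>_def)
        ultimately show ?thesis by simp
      qed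
      then show ?thesis by (simp add: preserves_def \<xi>_def)
    qed
    ultimately show ?thesis by (auto simp: polymorphism_clone_def)
  qed
  moreover have "\<xi> (minor A m f is) = minor B m (\<xi> f) is"
    if "f \<in> C" "is \<in> nlists (fst f) {..<m}" for f m "is"
  proof (rule prod_eqI)
    have sub: "set is \<subseteq> {..<m}" and len: "length is = fst f" using that(2) by (auto simp: nlists_def)
    show "snd (\<xi> (minor A m f is)) = snd (minor B m (\<xi> f) is)"
    proof
      fix bs
      show "snd (\<xi> (minor A m f is)) bs = snd (minor B m (\<xi> f) is) bs"
      proof (cases "bs \<in> nlists m B")
        case True
        then have "map ((!) bs) is \<in> nlists (fst f) B"
          using sub len by (auto simp: nlists_def subset_iff)
        then show ?thesis
          using True sub by (simp add: snd_minor free_term_minor \<xi>_def)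
      next
        case False
        then show ?thesis by (simp add: \<xi>_def) (simp add: minor_def compose_op_def)
      qed
    qed
  qed (simp add: \<xi>_def)
  ultimately show "h1_clone_homomorphism A C B (polymorphism_clone B Rs) \<xi>"
    by (auto simp: h1_clone_homomorphism_def minor_def \<xi>_def)
qed

theorem theorem1p11:
  fixes A :: "'a set" and C :: "'a operation set"
    and B :: "'b set" and Rs :: "'b relation set"
  assumes "function_clone A C"
    and "relational_structure B Rs"
  shows "(\<exists>\<xi>. h1_clone_homomorphism A C B (polymorphism_clone B Rs) \<xi>) \<longleftrightarrow> colorable A C B Rs"
  using coloring_of_h1_homomorphism[OF assms] h1_homomorphism_of_coloring[OF assms]
  by (auto simp: colorable_def)

end
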